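(* Let $m,n\in\mathbb{N}$, $a_1,\dots,a_m,c_1,\dots,c_m\in\mathbb{N}$ and $b_1,\dots,b_m\in\mathbb{N}_0$. Then $$\sum S_{(a_m,b_m,\pm c_m),(a_{m-1},b_{m-1},\pm c_{m-1}),\dots,(a_1,b_1,\pm c_1)}(2n)=2^m\,S_{(2a_m,b_m,c_m),\dots,(2a_1,b_1,c_1)}(n),$$ where the sum on the left-hand side runs over all $2^m$ choices of the signs $\pm$.
   Context: Cyclotomic harmonic sums: for $a_i\in\mathbb{N}=\{1,2,\dots\}$, $b_i\in\mathbb{N}_0$, $c_i\in\mathbb{Z}\setminus\{0\}$, $n\in\mathbb{N}_0$, $$S_{(a_1,b_1,c_1),\dots,(a_k,b_k,c_k)}(n)=\sum_{n\ge i_1\ge i_2\ge\cdots\ge i_k\ge1}\frac{\mathrm{sign}(c_1)^{i_1}}{(a_1i_1+b_1)^{|c_1|}}\cdots\frac{\mathrm{sign}(c_k)^{i_k}}{(a_ki_k+b_k)^{|c_k|}} .$$ *)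

theory Defs
  imports Complex_Main "HOL-Library.FuncSet"
begin

text \<open>
  The index list \<open>[(a\<^sub>1,b\<^sub>1,c\<^sub>1), \<dots>, (a\<^sub>k,b\<^sub>k,c\<^sub>k)]\<close> has intended range \<open>a\<^sub>i \<ge> 1\<close>, \<open>b\<^sub>i \<ge> 0\<close>, \<open>c\<^sub>i \<noteq> 0\<close>.
  A summation tuple \<open>n \<ge> i\<^sub>1 \<ge> \<dots> \<ge> i\<^sub>k \<ge> 1\<close> is a weakly decreasing list of length \<open>k\<close> with
  entries in \<open>{1..n}\<close>; list positions are zero-based.
\<close>

definition summation_tuples :: "nat \<Rightarrow> nat \<Rightarrow> nat list set" where
  "summation_tuples k n = {is. length is = k \<and> set is \<subseteq> {1..n} \<and> sorted_wrt (\<ge>) is}"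

definition cyc_term :: "nat \<times> nat \<times> int \<Rightarrow> nat \<Rightarrow> real" where
  "cyc_term = (\<lambda>(a, b, c) i. real_of_int (sgn c) ^ i / real (a * i + b) ^ nat \<bar>c\<bar>)"

definition cyc_harmonic_sum :: "(nat \<times> nat \<times> int) list \<Rightarrow> nat \<Rightarrow> real" where
  "cyc_harmonic_sum w n =
     (\<Sum>is\<in>summation_tuples (length w) n. \<Prod>j<length w. cyc_term (w ! j) (is ! j))"

end

theory Submission
  imports Defs
begin

text \<open>
  Expanding the sum over the signs turns each factor into the sum of its two signed versions, which
  vanishes at odd summation indices and doubles the unsigned factor at even ones. The summation
  tuples bounded by \<open>2n\<close> with only even entries are the doubled tuples bounded by \<open>n\<close>.
\<close>

lemma finite_summation_tuples: "finite (summation_tuples k n)"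
proof (rule finite_subset)
  show "summation_tuples k n \<subseteq> {is. set is \<subseteq> {1..n} \<and> length is = k}"
    by (auto simp: summation_tuples_def)
qed (simp add: finite_lists_length_eq)

lemma even_summation_tuples:
  "{is \<in> summation_tuples k (2 * n). \<forall>i\<in>set is. even i} = map ((*) 2) ` summation_tuples k n"
    (is "?E = ?D")
proof
  show "?E \<subseteq> ?D"
  proof
    fix "is" assume "is": "is \<in> ?E"
    let ?h = "map (\<lambda>i. i div 2) is"
    have "map ((*) 2) ?h = is"
      using "is" by (simp add: map_idI)
    \<comment> \<open>Halving is monotone, so the order survives; a positive even entry is at least
      2, so its half is at least 1.\<close>
    moreover have "?h \<in> summation_tuples k n"
      using "is" by (fastforce simp: summation_tuples_def sorted_wrt_map
          elim!: sorted_wrt_mono_rel[rotated] elim: evenE)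
    ultimately show "is \<in> ?D"
      by (metis image_eqI)
  qed
  show "?D \<subseteq> ?E"
    by (fastforce simp: summation_tuples_def sorted_wrt_map)
qed

text \<open>The two numerators add up to \<open>1 + (-1) ^ i\<close>. Positivity of \<open>c\<close>
  makes \<open>sgn (s * int c)\<close> equal to \<open>s\<close> instead of 0.\<close>

lemma sum_sign_cyc_term:
  assumes "c \<ge> 1"
  shows "(\<Sum>s\<in>{1, -1}. cyc_term (a, b, s * int c) i) =
    (if even i then 2 / real (a * i + b) ^ c else 0)"
  using assms by (auto simp: cyc_term_def sgn_mult abs_mult)

lemma cyc_term_double:
  assumes "c \<ge> 1"
  shows "cyc_term (2 * a, b, int c) i = 1 / real (a * (2 * i) + b) ^ c"
  using assms by (simp add: cyc_term_def mult_ac)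

text \<open>The parameters are listed from index \<open>m\<close> down to 1, so position
  \<open>j\<close> carries index \<open>m - j\<close>. Indexing the factors by
  \<open>k = m - j\<close> matches the domain \<open>{1..m}\<close> of the sign functions.\<close>

lemma cyc_harmonic_sum_map_rev_upt:
  "cyc_harmonic_sum (map f (rev [1..<Suc m])) n =
    (\<Sum>is\<in>summation_tuples m n. \<Prod>k\<in>{1..m}. cyc_term (f k) (is ! (m - k)))"
proof -
  have "(\<Prod>j<m. cyc_term (map f (rev [1..<Suc m]) ! j) (is ! j)) =
      (\<Prod>k\<in>{1..m}. cyc_term (f k) (is ! (m - k)))" for "is"
    by (rule prod.reindex_bij_witness[of _ "\<lambda>k. m - k" "\<lambda>j. m - j"])
       (auto simp: rev_nth Suc_diff_Suc simp del: upt_Suc)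
  then show ?thesis
    by (simp add: cyc_harmonic_sum_def del: upt_Suc)
qed

theorem theorem4p6p3:
  fixes m n :: nat and a b c :: "nat \<Rightarrow> nat"
  assumes "m \<ge> 1" and "n \<ge> 1"
    and "\<And>j. j \<in> {1..m} \<Longrightarrow> a j \<ge> 1"
    and "\<And>j. j \<in> {1..m} \<Longrightarrow> c j \<ge> 1"
  shows "(\<Sum>s\<in>{1..m} \<rightarrow>\<^sub>E {1, -1 :: int}.
            cyc_harmonic_sum (map (\<lambda>j. (a j, b j, s j * int (c j))) (rev [1..<Suc m])) (2 * n))
         = 2 ^ m * cyc_harmonic_sum (map (\<lambda>j. (2 * a j, b j, int (c j))) (rev [1..<Suc m])) n"
    (is "?L = ?R")
proof -
  let ?T = "summation_tuples m"
  define g where "g k i = (if even i then 2 / real (a k * i + b k) ^ c k else 0)" for k i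
  have "?L = (\<Sum>is\<in>?T (2 * n). \<Sum>s\<in>{1..m} \<rightarrow>\<^sub>E {1, -1}.
      \<Prod>k\<in>{1..m}. cyc_term (a k, b k, s k * int (c k)) (is ! (m - k)))"
    unfolding cyc_harmonic_sum_map_rev_upt by (rule sum.swap)
  \<comment> \<open>For a fixed tuple, the sign \<open>s k\<close> occurs only in factor
    \<open>k\<close>, so distributivity applies in reverse.\<close>
  also have "\<dots> = (\<Sum>is\<in>?T (2 * n). \<Prod>k\<in>{1..m}.
      \<Sum>s\<in>{1, -1}. cyc_term (a k, b k, s * int (c k)) (is ! (m - k)))"
    by (intro sum.cong refl prod_sum_PiE[symmetric]) auto
  also have "\<dots> = (\<Sum>is\<in>?T (2 * n). \<Prod>k\<in>{1..m}. g k (is ! (m - k)))"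
    unfolding g_def by (intro sum.cong prod.cong refl sum_sign_cyc_term assms(4))
  also have "\<dots> = (\<Sum>is\<in>{is \<in> ?T (2 * n). \<forall>i\<in>set is. even i}. \<Prod>k\<in>{1..m}. g k (is ! (m - k)))"
  proof (rule sum.mono_neutral_right)
    show "\<forall>is\<in>?T (2 * n) - {is \<in> ?T (2 * n). \<forall>i\<in>set is. even i}.
        (\<Prod>k\<in>{1..m}. g k (is ! (m - k))) = 0"
    proof
      fix "is" assume "is": "is \<in> ?T (2 * n) - {is \<in> ?T (2 * n). \<forall>i\<in>set is. even i}"
      then have "length is = m"
        by (simp add: summation_tuples_def)
      with "is" obtain j where "j < m" "odd (is ! j)"
        by (auto simp: in_set_conv_nth)
      \<comment> \<open>An odd entry at position \<open>j\<close> kills factor \<open>m - j\<close>;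
        \<open>j < m\<close> gives both \<open>m - j \<ge> 1\<close> and
        \<open>m - (m - j) = j\<close>.\<close>
      then have "m - j \<in> {1..m}" "g (m - j) (is ! (m - (m - j))) = 0"
        by (auto simp: g_def)
      then show "(\<Prod>k\<in>{1..m}. g k (is ! (m - k))) = 0"
        by (intro prod_zero) blast+
    qed
  qed (auto simp: finite_summation_tuples)
  also have "\<dots> = (\<Sum>is\<in>?T n. \<Prod>k\<in>{1..m}. g k (map ((*) 2) is ! (m - k)))"
    unfolding even_summation_tuples
    by (subst sum.reindex) (auto intro!: inj_onI dest: map_injective simp: inj_on_def)
  also have "\<dots> = (\<Sum>is\<in>?T n. \<Prod>k\<in>{1..m}.
      2 * cyc_term (2 * a k, b k, int (c k)) (is ! (m - k)))"
  proof (intro sum.cong prod.cong refl)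
    fix "is" k assume "is \<in> ?T n" "k \<in> {1..m}"
    \<comment> \<open>As \<open>k \<ge> 1\<close>, position \<open>m - k\<close> lies inside the
      list; its doubled entry is even, and \<open>a k * (2 * i) = 2 * a k * i\<close>.\<close>
    then show "g k (map ((*) 2) is ! (m - k)) =
        2 * cyc_term (2 * a k, b k, int (c k)) (is ! (m - k))"
      using assms(4)[of k] by (simp add: cyc_term_double g_def summation_tuples_def)
  qed
  \<comment> \<open>Each of the \<open>m\<close> factors contributes one 2.\<close>
  also have "\<dots> = ?R"
    unfolding cyc_harmonic_sum_map_rev_upt
    by (simp add: prod.distrib sum_distrib_left)
  finally show ?thesis .
qed

end
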